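(* Let $\gamma,c,d_0>0$. Consider any algorithm in the cost-weighted hierarchy oracle model that returns $\hat y$ with $\mathbb{E}[\mathcal{L}(\hat y)-\mathcal{L}^\ast]\le\varepsilon$ on every instance $(\mathcal{L},\mathcal{A})$ of that model (rate $\gamma$, prefactor $c$, $\mathcal{L}$ convex and $\beta$-smooth) with $\|y_0-y^\ast\|\le d_0$. If $\varepsilon\le\beta d_0^2/8$, then on some such instance $$\mathbb{E}[\mathrm{Cost}]\ \ge\ \tfrac34\,8^{-\gamma}\Big(\frac{c\,d_0}{\varepsilon}\Big)^{\gamma}.$$ If the algorithm is required to succeed on $\mu$-strongly convex such instances, with $\varepsilon\le\mu d_0^2/8$, then on some such instance $$\mathbb{E}[\mathrm{Cost}]\ \ge\ \tfrac34\Big(\frac{c}{\sqrt{8\mu\varepsilon}}\Big)^{\gamma}.$$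
   Context: Here $0<\mu\le\beta$, $y^\ast$ denotes a minimizer of $\mathcal{L}$, $\mathcal{L}^\ast=\mathcal{L}(y^\ast)$, and $y_0$ is the starting point. Instances live on $\mathbb{R}^d$. Dyadic hierarchy of rate $\gamma$ and prefactor $c$ for $\nabla\mathcal{L}$: a family $\mathcal{A}=(A_k)_k$ (integer $k$) of algorithms computing maps $\mathbb{R}^d\to\mathbb{R}^d$ with $\sup_y\|A_k(y)-\nabla\mathcal{L}(y)\|\le2^{-k}$ and $\mathrm{Cost}(A_k)\le c^\gamma2^{\gamma k}$. Cost-weighted hierarchy oracle model: an instance is a pair $(\mathcal{L},\mathcal{A})$ with $\mathcal{L}$ convex and $\beta$-smooth and $\mathcal{A}=(A_k)_k$ a dyadic hierarchy for $\nabla\mathcal{L}$ of rate $\gamma$ and prefactor $c$. An algorithm interacts with an instance in rounds. At round $t$ it selects, as a measurable function of the answers received so far and of its own internal randomness, a point $y_t$ and a level $k_t$; it receives $A_{k_t}(y_t)$ and pays $c^\gamma2^{\gamma k_t}$. After a possibly random number of rounds it outputs $\hat y$, and its cost is $\mathrm{Cost}=\sum_t c^\gamma2^{\gamma k_t}$. Computation between queries is free. *)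

theory Defs
  imports "HOL-Probability.Probability"
begin

definition grad :: "('a::euclidean_space \<Rightarrow> real) \<Rightarrow> 'a \<Rightarrow> 'a"
  where "grad L y = (THE g. GDERIV L y :> g)"

definition smooth :: "real \<Rightarrow> ('a::euclidean_space \<Rightarrow> real) \<Rightarrow> bool"
  where "smooth \<beta> L \<longleftrightarrow> (\<forall>y. L differentiable (at y)) \<and> \<beta>-lipschitz_on UNIV (grad L)"

definition strongly_convex :: "real \<Rightarrow> ('a::euclidean_space \<Rightarrow> real) \<Rightarrow> bool"
  where "strongly_convex \<mu> L \<longleftrightarrow>
    (\<forall>x y. \<forall>t\<in>{0..1}. L ((1 - t) *\<^sub>R x + t *\<^sub>R y)
       \<le> (1 - t) * L x + t * L y - \<mu> / 2 * t * (1 - t) * (norm (x - y))\<^sup>2)"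

definition minimizer :: "('a::euclidean_space \<Rightarrow> real) \<Rightarrow> 'a \<Rightarrow> bool"
  where "minimizer L y \<longleftrightarrow> (\<forall>z. L y \<le> L z)"

text \<open>The algorithms of a hierarchy matter only through the map they compute and their cost.\<close>

record 'a costed_map =
  computed :: "'a \<Rightarrow> 'a"
  cost_of :: real

definition level_cost :: "real \<Rightarrow> real \<Rightarrow> int \<Rightarrow> real"
  where "level_cost \<gamma> c k = c powr \<gamma> * 2 powr (\<gamma> * of_int k)"

text \<open>Measurability of the computed maps is what makes the output and the cost of a randomized
  algorithm random variables.\<close>

definition dyadic_hierarchy ::
    "real \<Rightarrow> real \<Rightarrow> ('a::euclidean_space \<Rightarrow> real) \<Rightarrow> (int \<Rightarrow> 'a costed_map) \<Rightarrow> bool"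
  where "dyadic_hierarchy \<gamma> c L A \<longleftrightarrow>
    (\<forall>k. computed (A k) \<in> borel_measurable borel
       \<and> (\<forall>y. norm (computed (A k) y - grad L y) \<le> 2 powr (- of_int k))
       \<and> 0 \<le> cost_of (A k) \<and> cost_of (A k) \<le> level_cost \<gamma> c k)"

definition hierarchy_instance ::
    "real \<Rightarrow> real \<Rightarrow> real \<Rightarrow> ('a::euclidean_space \<Rightarrow> real) \<Rightarrow> (int \<Rightarrow> 'a costed_map) \<Rightarrow> bool"
  where "hierarchy_instance \<gamma> c \<beta> L A \<longleftrightarrow>
    convex_on UNIV L \<and> smooth \<beta> L \<and> dyadic_hierarchy \<gamma> c L A"

text \<open>After \<open>t\<close> answers, stored as an element of the product over \<open>{..<t}\<close>, the algorithm either
  stops and outputs a point, or issues the query \<open>(point, level)\<close> of round \<open>t\<close>. A single sample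
  \<open>\<omega>\<close> from the seed space carries the internal randomness of all rounds.\<close>

record ('r, 'a) oracle_algorithm =
  seed :: "'r measure"
  query_point :: "nat \<Rightarrow> 'r \<times> (nat \<Rightarrow> 'a) \<Rightarrow> 'a"
  query_level :: "nat \<Rightarrow> 'r \<times> (nat \<Rightarrow> 'a) \<Rightarrow> int"
  stops :: "nat \<Rightarrow> 'r \<times> (nat \<Rightarrow> 'a) \<Rightarrow> bool"
  result :: "nat \<Rightarrow> 'r \<times> (nat \<Rightarrow> 'a) \<Rightarrow> 'a"

definition view_space ::
    "('r, 'a::euclidean_space) oracle_algorithm \<Rightarrow> nat \<Rightarrow> ('r \<times> (nat \<Rightarrow> 'a)) measure"
  where "view_space P t = seed P \<Otimes>\<^sub>M (\<Pi>\<^sub>M i\<in>{..<t}. borel)"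

definition valid_algorithm :: "('r, 'a::euclidean_space) oracle_algorithm \<Rightarrow> bool"
  where "valid_algorithm P \<longleftrightarrow>
    prob_space (seed P) \<and>
    (\<forall>t. query_point P t \<in> view_space P t \<rightarrow>\<^sub>M borel
       \<and> query_level P t \<in> view_space P t \<rightarrow>\<^sub>M count_space UNIV
       \<and> stops P t \<in> view_space P t \<rightarrow>\<^sub>M count_space UNIV
       \<and> result P t \<in> view_space P t \<rightarrow>\<^sub>M borel)"

text \<open>The answers of rounds \<open>0, \<dots>, t - 1\<close>; beyond the stopping round this is a harmless
  continuation that neither the output nor the cost looks at.\<close>

primrec answers :: "('r, 'a::euclidean_space) oracle_algorithm \<Rightarrow> (int \<Rightarrow> 'a costed_map)
    \<Rightarrow> 'r \<Rightarrow> nat \<Rightarrow> nat \<Rightarrow> 'a"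
  where
    "answers P A \<omega> 0 = (\<lambda>_. undefined)"
  | "answers P A \<omega> (Suc t) = (answers P A \<omega> t)
       (t := computed (A (query_level P t (\<omega>, answers P A \<omega> t)))
                      (query_point P t (\<omega>, answers P A \<omega> t)))"

definition stopped :: "('r, 'a::euclidean_space) oracle_algorithm \<Rightarrow> (int \<Rightarrow> 'a costed_map)
    \<Rightarrow> 'r \<Rightarrow> nat \<Rightarrow> bool"
  where "stopped P A \<omega> t \<longleftrightarrow> (\<exists>s\<le>t. stops P s (\<omega>, answers P A \<omega> s))"

definition final_output :: "('r, 'a::euclidean_space) oracle_algorithm \<Rightarrow> (int \<Rightarrow> 'a costed_map)
    \<Rightarrow> 'r \<Rightarrow> 'a"
  where "final_output P A \<omega> = (let N = (LEAST t. stopped P A \<omega> t) in result P N (\<omega>, answers P A \<omega> N))"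

definition run_cost :: "real \<Rightarrow> real \<Rightarrow> ('r, 'a::euclidean_space) oracle_algorithm
    \<Rightarrow> (int \<Rightarrow> 'a costed_map) \<Rightarrow> 'r \<Rightarrow> ennreal"
  where "run_cost \<gamma> c P A \<omega> =
    (\<Sum>t. if stopped P A \<omega> t then 0
         else ennreal (level_cost \<gamma> c (query_level P t (\<omega>, answers P A \<omega> t))))"

definition expected_cost :: "real \<Rightarrow> real \<Rightarrow> ('r, 'a::euclidean_space) oracle_algorithm
    \<Rightarrow> (int \<Rightarrow> 'a costed_map) \<Rightarrow> ennreal"
  where "expected_cost \<gamma> c P A = (\<integral>\<^sup>+ \<omega>. run_cost \<gamma> c P A \<omega> \<partial>seed P)"

text \<open>For a minimizer \<open>ystar\<close> of \<open>L\<close> the gap is nonnegative, so no truncation occurs in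
  \<open>ennreal\<close>.\<close>

definition succeeds :: "real \<Rightarrow> ('r, 'a::euclidean_space) oracle_algorithm
    \<Rightarrow> ('a \<Rightarrow> real) \<Rightarrow> (int \<Rightarrow> 'a costed_map) \<Rightarrow> 'a \<Rightarrow> bool"
  where "succeeds \<epsilon> P L A ystar \<longleftrightarrow>
    (AE \<omega> in seed P. \<exists>t. stopped P A \<omega> t) \<and>
    (\<integral>\<^sup>+ \<omega>. ennreal (L (final_output P A \<omega>) - L ystar) \<partial>seed P) \<le> ennreal \<epsilon>"

end

theory Submission
  imports Defs
begin

text \<open>
  This is a two-point lower bound. Fix a curvature \<open>m\<close>, put \<open>a = sqrt (8 * \<epsilon> / m)\<close>, and let
  \<open>e\<close> be a unit vector. The quadratics with curvature \<open>m\<close> centred at \<open>y\<^sub>0 + a e\<close> and \<open>y\<^sub>0 - a e\<close>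
  have gradients \<open>m (y - y\<^sub>0) \<mp> m a e\<close>, so the single map \<open>y \<mapsto> m (y - y\<^sub>0)\<close> approximates both
  gradients to accuracy \<open>m * a = sqrt (8 * m * \<epsilon>)\<close>. Every level \<open>k\<close> with
  \<open>2 powr - k \<ge> m * a\<close> may therefore return this common map in both instances
  (\<open>dyadic_hierarchy_hiding_center\<close>), and an algorithm that never asks a finer level behaves
  identically on the two instances (\<open>final_output_eq_if_not_separated\<close>).

  By the parallelogram law the two optimality gaps of any common output add up to at least
  \<open>m * a\<^sup>2 = 8 * \<epsilon>\<close>, whereas the two expected gaps add up to at most \<open>2 * \<epsilon>\<close>. Hence a finer level
  is queried with probability at least \<open>3/4\<close> (\<open>two_point_cost_bound\<close>), and one such query already
  costs \<open>(c / (m * a)) powr \<gamma>\<close>; together this is \<open>quadratic_pair_cost_bound\<close>.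

  Both halves of the theorem are this bound for different curvatures. In the strongly convex case
  \<open>m = \<mu>\<close>, and \<open>\<epsilon> \<le> \<mu> * d\<^sub>0\<^sup>2 / 8\<close> says that the centres lie within \<open>d\<^sub>0\<close> of \<open>y\<^sub>0\<close>. In the convex case
  \<open>m\<close> is free; the bound improves as \<open>m\<close> decreases, and the smallest \<open>m\<close> that keeps \<open>a \<le> d\<^sub>0\<close> is
  \<open>8 * \<epsilon> / d\<^sub>0\<^sup>2\<close>, for which \<open>a = d\<^sub>0\<close>; \<open>\<epsilon> \<le> \<beta> * d\<^sub>0\<^sup>2 / 8\<close> says that this curvature is at most \<open>\<beta>\<close>.
\<close>

section \<open>Measurability of a run\<close>

lemma measurable_view:
  fixes P :: "('r, 'a::euclidean_space) oracle_algorithm"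
  assumes "valid_algorithm P" and A: "\<And>k. computed (A k) \<in> borel_measurable borel"
  shows "(\<lambda>\<omega>. (\<omega>, answers P A \<omega> t)) \<in> seed P \<rightarrow>\<^sub>M view_space P t"
proof -
  have "(\<lambda>\<omega>. answers P A \<omega> t) \<in> seed P \<rightarrow>\<^sub>M (\<Pi>\<^sub>M i\<in>{..<t}. borel)"
  proof (induction t)
    case 0
    show ?case by (simp add: space_PiM)
  next
    case (Suc t)
    have view: "(\<lambda>\<omega>. (\<omega>, answers P A \<omega> t)) \<in> seed P \<rightarrow>\<^sub>M view_space P t"
      unfolding view_space_def by (intro measurable_Pair measurable_ident_sets refl Suc)
    have [measurable]: "(\<lambda>\<omega>. query_point P t (\<omega>, answers P A \<omega> t)) \<in> borel_measurable (seed P)"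
      "(\<lambda>\<omega>. query_level P t (\<omega>, answers P A \<omega> t)) \<in> seed P \<rightarrow>\<^sub>M count_space UNIV"
      using assms(1) view unfolding valid_algorithm_def by (auto intro: measurable_compose)
    have "(\<lambda>\<omega>. computed (A (query_level P t (\<omega>, answers P A \<omega> t)))
        (query_point P t (\<omega>, answers P A \<omega> t))) \<in> borel_measurable (seed P)"
      by (rule measurable_compose_countable[where f = "\<lambda>k \<omega>. computed (A k) (query_point P t (\<omega>, answers P A \<omega> t))"])
        (use A in \<open>auto intro: measurable_compose[rotated]\<close>)
    then show ?case
      unfolding answers.simps
      by (intro measurable_fun_upd[where J = "{..<t}"] Suc) auto
  qed
  then show ?thesis
    unfolding view_space_def by (intro measurable_Pair measurable_ident_sets refl)
qed

lemma measurable_stopped: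
  fixes P :: "('r, 'a::euclidean_space) oracle_algorithm"
  assumes "valid_algorithm P" and "\<And>k. computed (A k) \<in> borel_measurable borel"
  shows "Measurable.pred (seed P) (\<lambda>\<omega>. stopped P A \<omega> t)"
proof -
  have "(\<lambda>\<omega>. stops P s (\<omega>, answers P A \<omega> s)) \<in> seed P \<rightarrow>\<^sub>M count_space UNIV" for s
    using assms(1) measurable_view[where A = A and t = s, OF assms] unfolding valid_algorithm_def
    by (auto intro: measurable_compose)
  then show ?thesis
    unfolding stopped_def by measurable
qed

lemma measurable_query_level:
  fixes P :: "('r, 'a::euclidean_space) oracle_algorithm"
  assumes "valid_algorithm P" and "\<And>k. computed (A k) \<in> borel_measurable borel"
  shows "(\<lambda>\<omega>. query_level P t (\<omega>, answers P A \<omega> t)) \<in> seed P \<rightarrow>\<^sub>M count_space UNIV"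
  using assms(1) measurable_view[where A = A and t = t, OF assms] unfolding valid_algorithm_def
  by (auto intro: measurable_compose)

lemma measurable_final_output:
  fixes P :: "('r, 'a::euclidean_space) oracle_algorithm"
  assumes "valid_algorithm P" and "\<And>k. computed (A k) \<in> borel_measurable borel"
  shows "final_output P A \<in> borel_measurable (seed P)"
proof -
  note [measurable] = measurable_stopped[where A = A, OF assms]
  have [measurable]: "(\<lambda>\<omega>. result P t (\<omega>, answers P A \<omega> t)) \<in> borel_measurable (seed P)" for t
    using assms(1) measurable_view[where A = A and t = t, OF assms] unfolding valid_algorithm_def
    by (auto intro: measurable_compose)
  have "(\<lambda>\<omega>. LEAST t. stopped P A \<omega> t) \<in> seed P \<rightarrow>\<^sub>M count_space UNIV"
    by measurable
  then have "(\<lambda>\<omega>. result P (LEAST t. stopped P A \<omega> t)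
      (\<omega>, answers P A \<omega> (LEAST t. stopped P A \<omega> t))) \<in> borel_measurable (seed P)"
    by (rule measurable_compose_countable[rotated]) measurable
  then show ?thesis
    unfolding final_output_def[abs_def] Let_def .
qed

section \<open>Runs that never separate two hierarchies\<close>

definition queries_level_in :: "('r, 'a::euclidean_space) oracle_algorithm
    \<Rightarrow> (int \<Rightarrow> 'a costed_map) \<Rightarrow> int set \<Rightarrow> 'r \<Rightarrow> bool"
  where "queries_level_in P A K \<omega> \<longleftrightarrow>
    (\<exists>t. \<not> stopped P A \<omega> t \<and> query_level P t (\<omega>, answers P A \<omega> t) \<in> K)"

lemma measurable_queries_level_in:
  fixes P :: "('r, 'a::euclidean_space) oracle_algorithm"
  assumes "valid_algorithm P" and "\<And>k. computed (A k) \<in> borel_measurable borel"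
  shows "Measurable.pred (seed P) (queries_level_in P A K)"
proof -
  note [measurable] = measurable_stopped[where A = A, OF assms] measurable_query_level[where A = A, OF assms]
  show ?thesis
    unfolding queries_level_in_def[abs_def] by measurable
qed

lemma answers_eq_if_not_separated:
  fixes P :: "('r, 'a::euclidean_space) oracle_algorithm"
  assumes agree: "\<And>k. k \<notin> K \<Longrightarrow> computed (A k) = computed (B k)"
    and "\<not> queries_level_in P A K \<omega>" and "\<And>s. s < t \<Longrightarrow> \<not> stopped P A \<omega> s"
  shows "answers P A \<omega> t = answers P B \<omega> t"
  using assms(3)
proof (induction t)
  case (Suc t)
  then have eq: "answers P A \<omega> t = answers P B \<omega> t" by auto
  have "query_level P t (\<omega>, answers P A \<omega> t) \<notin> K"
    using assms(2) Suc.prems[of t] unfolding queries_level_in_def by auto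
  from agree[OF this] eq show ?case by simp
qed simp

text \<open>The two transcripts coincide up to and including the round at which the first run stops, so
  the second run stops in the same round and reads off the same result.\<close>

lemma final_output_eq_if_not_separated:
  fixes P :: "('r, 'a::euclidean_space) oracle_algorithm"
  assumes agree: "\<And>k. k \<notin> K \<Longrightarrow> computed (A k) = computed (B k)"
    and sep: "\<not> queries_level_in P A K \<omega>" and "\<exists>t. stopped P A \<omega> t"
  shows "final_output P A \<omega> = final_output P B \<omega>"
proof -
  define N where "N = (LEAST t. stopped P A \<omega> t)"
  have N: "stopped P A \<omega> N"
    unfolding N_def using assms(3) by (rule LeastI_ex)
  have before: "\<not> stopped P A \<omega> s" if "s < N" for s
    using that unfolding N_def by (rule not_less_Least)
  have eq: "answers P A \<omega> t = answers P B \<omega> t" if "t \<le> N" for t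
    by (rule answers_eq_if_not_separated[where K = K]) (use agree sep before that in auto)
  have st: "stopped P B \<omega> t \<longleftrightarrow> stopped P A \<omega> t" if "t \<le> N" for t
    unfolding stopped_def using eq that by auto
  have "(LEAST t. stopped P B \<omega> t) = N"
    by (rule Least_equality) (use N before st in \<open>auto simp: not_le[symmetric]\<close>, metis linorder_le_cases)
  then show ?thesis
    using eq[of N] unfolding final_output_def Let_def N_def[symmetric] by simp
qed

lemma run_cost_ge_if_queries_level_in:
  fixes P :: "('r, 'a::euclidean_space) oracle_algorithm"
  assumes "\<And>k. k \<in> K \<Longrightarrow> C \<le> level_cost \<gamma> c k" and "queries_level_in P A K \<omega>"
  shows "ennreal C \<le> run_cost \<gamma> c P A \<omega>"
proof -
  obtain t where t: "\<not> stopped P A \<omega> t" "query_level P t (\<omega>, answers P A \<omega> t) \<in> K"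
    using assms(2) unfolding queries_level_in_def by auto
  let ?f = "\<lambda>t. if stopped P A \<omega> t then 0
    else ennreal (level_cost \<gamma> c (query_level P t (\<omega>, answers P A \<omega> t)))"
  have "ennreal C \<le> ?f t"
    using t assms(1) by (auto intro: ennreal_leI)
  also have "\<dots> = sum ?f {t}" by simp
  also have "\<dots> \<le> (\<Sum>t. ?f t)"
    by (rule sum_le_suminf) auto
  finally show ?thesis unfolding run_cost_def .
qed

section \<open>The two-point bound\<close>

text \<open>Unless the run on \<open>A\<close> queries a level in \<open>K\<close>, both runs output the same point, whose two
  gaps add up to at least \<open>q\<close>. Since both expected gaps are at most \<open>\<epsilon>\<close>, Markov's inequality bounds the probability
  of that case by \<open>2 * \<epsilon> / q\<close>.\<close>

lemma two_point_cost_bound: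
  fixes P :: "('r, 'a::euclidean_space) oracle_algorithm"
  assumes valid: "valid_algorithm P"
    and A: "\<And>k. computed (A k) \<in> borel_measurable borel"
    and B: "\<And>k. computed (B k) \<in> borel_measurable borel"
    and agree: "\<And>k. k \<notin> K \<Longrightarrow> computed (A k) = computed (B k)"
    and price: "\<And>k. k \<in> K \<Longrightarrow> C \<le> level_cost \<gamma> c k" and "0 \<le> C"
    and [measurable]: "L \<in> borel_measurable borel" "L' \<in> borel_measurable borel"
    and min: "minimizer L x" "minimizer L' x'"
    and gap: "\<And>y. q \<le> (L y - L x) + (L' y - L' x')" and "0 < q" and "0 \<le> \<epsilon>"
    and succ: "succeeds \<epsilon> P L A x" "succeeds \<epsilon> P L' B x'"
  shows "ennreal ((1 - 2 * \<epsilon> / q) * C) \<le> expected_cost \<gamma> c P A"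
proof -
  interpret prob_space "seed P"
    using valid unfolding valid_algorithm_def by simp
  note [measurable] = measurable_final_output[where A = A, OF valid A] measurable_final_output[where A = B, OF valid B]
  define S where "S = {\<omega> \<in> space (seed P). queries_level_in P A K \<omega>}"
  have S [measurable]: "S \<in> sets (seed P)"
    using measurable_queries_level_in[where A = A and K = K, OF valid A] unfolding S_def pred_def .
  define g where "g \<omega> = ennreal (L (final_output P A \<omega>) - L x)" for \<omega>
  define h where "h \<omega> = ennreal (L' (final_output P B \<omega>) - L' x')" for \<omega>
  have [measurable]: "g \<in> borel_measurable (seed P)" "h \<in> borel_measurable (seed P)"
    unfolding g_def[abs_def] h_def[abs_def] by measurable
  have "AE \<omega> in seed P. \<exists>t. stopped P A \<omega> t"
    using succ unfolding succeeds_def by simp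
  then have "AE \<omega> in seed P. ennreal q * indicator (space (seed P) - S) \<omega> \<le> g \<omega> + h \<omega>"
  proof (rule AE_mp, intro AE_I2 impI)
    fix \<omega> assume \<omega>: "\<omega> \<in> space (seed P)" and stop: "\<exists>t. stopped P A \<omega> t"
    show "ennreal q * indicator (space (seed P) - S) \<omega> \<le> g \<omega> + h \<omega>"
    proof (cases "\<omega> \<in> S")
      case False
      then have "final_output P A \<omega> = final_output P B \<omega>"
        using \<omega> stop agree unfolding S_def
        by (intro final_output_eq_if_not_separated[where K = K]) auto
      then have "g \<omega> + h \<omega> = ennreal ((L (final_output P A \<omega>) - L x) + (L' (final_output P A \<omega>) - L' x'))"
        unfolding g_def h_def using min by (subst ennreal_plus) (auto simp: minimizer_def)
      then show ?thesis
        using False \<omega> gap by (auto intro: ennreal_leI)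
    qed simp
  qed
  then have "(\<integral>\<^sup>+ \<omega>. ennreal q * indicator (space (seed P) - S) \<omega> \<partial>seed P)
      \<le> (\<integral>\<^sup>+ \<omega>. g \<omega> + h \<omega> \<partial>seed P)"
    by (rule nn_integral_mono_AE)
  also have "\<dots> = (\<integral>\<^sup>+ \<omega>. g \<omega> \<partial>seed P) + (\<integral>\<^sup>+ \<omega>. h \<omega> \<partial>seed P)"
    by (rule nn_integral_add) auto
  also have "\<dots> \<le> ennreal \<epsilon> + ennreal \<epsilon>"
    using succ unfolding succeeds_def g_def h_def by (intro add_mono) auto
  also have "(\<integral>\<^sup>+ \<omega>. ennreal q * indicator (space (seed P) - S) \<omega> \<partial>seed P)
      = ennreal (q * (1 - prob S))"
    using \<open>0 < q\<close> by (subst nn_integral_cmult_indicator) (auto simp: emeasure_eq_measure prob_compl ennreal_mult)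
  finally have "q * (1 - prob S) \<le> 2 * \<epsilon>"
    using \<open>0 \<le> \<epsilon>\<close> by (simp add: ennreal_plus[symmetric] del: ennreal_plus)
  then have "1 - 2 * \<epsilon> / q \<le> prob S"
    using \<open>0 < q\<close> by (simp add: field_simps)
  then have "ennreal ((1 - 2 * \<epsilon> / q) * C) \<le> ennreal (C * prob S)"
    using \<open>0 \<le> C\<close> by (intro ennreal_leI) (simp add: mult.commute mult_left_mono)
  also have "\<dots> = (\<integral>\<^sup>+ \<omega>. ennreal C * indicator S \<omega> \<partial>seed P)"
    using \<open>0 \<le> C\<close> by (subst nn_integral_cmult_indicator) (auto simp: emeasure_eq_measure ennreal_mult)
  also have "\<dots> \<le> expected_cost \<gamma> c P A"
    unfolding expected_cost_def
    by (intro nn_integral_mono)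
      (auto simp: S_def indicator_def intro!: run_cost_ge_if_queries_level_in[where K = K] price)
  finally show ?thesis .
qed

section \<open>Quadratics with a hidden centre\<close>

definition quadratic :: "real \<Rightarrow> 'a::euclidean_space \<Rightarrow> 'a \<Rightarrow> real"
  where "quadratic m z y = m / 2 * (norm (y - z))\<^sup>2"

lemma GDERIV_quadratic: "GDERIV (quadratic m z) y :> m *\<^sub>R (y - z)"
proof -
  have "((\<lambda>y. m / 2 * ((y - z) \<bullet> (y - z))) has_derivative (\<lambda>h. h \<bullet> (m *\<^sub>R (y - z)))) (at y)"
    by (auto intro!: derivative_eq_intros simp: inner_commute)
  then show ?thesis
    unfolding gderiv_def quadratic_def[abs_def] by (simp add: power2_norm_eq_inner)
qed

lemma grad_quadratic: "grad (quadratic m z) y = m *\<^sub>R (y - z)"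
  unfolding grad_def
proof (rule the_equality)
  show "GDERIV (quadratic m z) y :> m *\<^sub>R (y - z)"
    by (rule GDERIV_quadratic)
next
  fix g assume "GDERIV (quadratic m z) y :> g"
  then have "(\<lambda>h. h \<bullet> g) = (\<lambda>h. h \<bullet> (m *\<^sub>R (y - z)))"
    using GDERIV_quadratic[of m z y] unfolding gderiv_def by (rule has_derivative_unique)
  then have "\<forall>h. h \<bullet> g = h \<bullet> (m *\<^sub>R (y - z))"
    unfolding fun_eq_iff .
  then show "g = m *\<^sub>R (y - z)"
    by (rule vector_eq_ldot[THEN iffD1])
qed

lemma smooth_quadratic:
  assumes "0 \<le> m" and "m \<le> \<beta>"
  shows "smooth \<beta> (quadratic m z)"
  unfolding smooth_def
proof (intro conjI allI)
  show "quadratic m z differentiable (at y)" for y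
    using GDERIV_quadratic[of m z y] unfolding gderiv_def differentiable_def by blast
  have "dist (grad (quadratic m z) x) (grad (quadratic m z) y) = m * dist x y" for x y
    using assms by (simp add: grad_quadratic dist_norm flip: scaleR_diff_right)
  then show "\<beta>-lipschitz_on UNIV (grad (quadratic m z))"
    using assms by (intro lipschitz_onI) (auto intro: mult_right_mono)
qed

text \<open>For a quadratic the defining inequality of strong convexity is an identity.\<close>

lemma strongly_convex_quadratic: "strongly_convex m (quadratic m z)"
proof -
  have "quadratic m z ((1 - t) *\<^sub>R x + t *\<^sub>R y)
      = (1 - t) * quadratic m z x + t * quadratic m z y - m / 2 * t * (1 - t) * (norm (x - y))\<^sup>2"
    for x y and t :: real
  proof -
    have "(1 - t) *\<^sub>R x + t *\<^sub>R y - z = (1 - t) *\<^sub>R (x - z) + t *\<^sub>R (y - z)"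
      by (simp add: algebra_simps)
    moreover have "x - y = (x - z) - (y - z)" by simp
    ultimately show ?thesis
      unfolding quadratic_def power2_norm_eq_inner
      by (simp add: inner_add_left inner_add_right inner_diff_left inner_diff_right inner_commute field_simps)
  qed
  then show ?thesis unfolding strongly_convex_def by simp
qed

lemma convex_on_if_strongly_convex:
  fixes L :: "'a::euclidean_space \<Rightarrow> real"
  assumes "strongly_convex m L" and "0 \<le> m"
  shows "convex_on UNIV L"
proof (rule convex_onI)
  fix t :: real and x y :: 'a
  assume t: "0 < t" "t < 1"
  then have "0 \<le> m / 2 * t * (1 - t) * (norm (x - y))\<^sup>2"
    using assms(2) by simp
  moreover have "L ((1 - t) *\<^sub>R x + t *\<^sub>R y)
      \<le> (1 - t) * L x + t * L y - m / 2 * t * (1 - t) * (norm (x - y))\<^sup>2"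
    using assms(1) t unfolding strongly_convex_def by simp
  ultimately show "L ((1 - t) *\<^sub>R x + t *\<^sub>R y) \<le> (1 - t) * L x + t * L y"
    by linarith
qed simp

lemma minimizer_quadratic: "0 \<le> m \<Longrightarrow> minimizer (quadratic m z) z"
  by (simp add: minimizer_def quadratic_def)

text \<open>This is the parallelogram law.\<close>

lemma quadratic_gap_sum:
  assumes "0 \<le> m"
  shows "m * (norm v)\<^sup>2 \<le> quadratic m (x + v) y + quadratic m (x - v) y"
proof -
  have "quadratic m (x + v) y + quadratic m (x - v) y = m * ((norm (y - x))\<^sup>2 + (norm v)\<^sup>2)"
    unfolding quadratic_def power2_norm_eq_inner
    by (simp add: inner_add_left inner_add_right inner_diff_left inner_diff_right inner_commute field_simps)
  then show ?thesis
    using assms by (simp add: mult_left_mono)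
qed

definition fine_levels :: "real \<Rightarrow> int set"
  where "fine_levels \<delta> = {k. 2 powr (- of_int k) < \<delta>}"

text \<open>A hierarchy for \<open>quadratic m z\<close> that answers every level of accuracy \<open>\<delta>\<close> or coarser with the
  gradient of the quadratic centred at \<open>x\<close>, and so hides the true centre \<open>z\<close>.\<close>

definition hiding_hierarchy ::
    "real \<Rightarrow> real \<Rightarrow> real \<Rightarrow> 'a::euclidean_space \<Rightarrow> real \<Rightarrow> 'a \<Rightarrow> int \<Rightarrow> 'a costed_map"
  where "hiding_hierarchy \<gamma> c m x \<delta> z k =
    \<lparr>computed = (\<lambda>y. m *\<^sub>R (y - (if k \<in> fine_levels \<delta> then z else x))),
     cost_of = level_cost \<gamma> c k\<rparr>"

lemma dyadic_hierarchy_hiding_center: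
  assumes "0 \<le> m" and "m * norm (z - x) \<le> \<delta>"
  shows "dyadic_hierarchy \<gamma> c (quadratic m z) (hiding_hierarchy \<gamma> c m x \<delta> z)"
  unfolding dyadic_hierarchy_def
proof (intro allI conjI)
  fix k y
  have "m *\<^sub>R (y - x) - m *\<^sub>R (y - z) = m *\<^sub>R (z - x)"
    by (simp add: algebra_simps)
  then show "norm (computed (hiding_hierarchy \<gamma> c m x \<delta> z k) y - grad (quadratic m z) y)
      \<le> 2 powr (- of_int k)"
    using assms by (auto simp: hiding_hierarchy_def fine_levels_def grad_quadratic)
qed (auto simp: hiding_hierarchy_def level_cost_def)

lemma level_cost_ge_if_fine:
  assumes "0 < \<gamma>" and "0 < c" and "0 < \<delta>" and "k \<in> fine_levels \<delta>"
  shows "(c / \<delta>) powr \<gamma> \<le> level_cost \<gamma> c k"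
proof -
  have "inverse \<delta> \<le> 2 powr (of_int k)"
    using assms(3,4) by (simp add: fine_levels_def powr_minus field_simps)
  then have "inverse \<delta> powr \<gamma> \<le> (2 powr (of_int k)) powr \<gamma>"
    using assms by (intro powr_mono2) auto
  then have "c powr \<gamma> * inverse \<delta> powr \<gamma> \<le> c powr \<gamma> * 2 powr (\<gamma> * of_int k)"
    by (intro mult_left_mono) (auto simp: powr_powr mult.commute)
  then show ?thesis
    using assms unfolding level_cost_def by (simp add: powr_mult divide_inverse)
qed

text \<open>An algorithm that succeeds on all convex instances in particular succeeds on the
  \<open>m\<close>-strongly convex ones, and a strongly convex witness is a convex one, so this serves both
  halves of the theorem.\<close>

lemma quadratic_pair_cost_bound:
  fixes \<gamma> c d\<^sub>0 \<beta> m \<epsilon> :: real and y\<^sub>0 :: "'a::euclidean_space"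
    and P :: "('r, 'a) oracle_algorithm"
  assumes "0 < \<gamma>" and "0 < c" and "0 < d\<^sub>0" and "0 < m" and "m \<le> \<beta>" and "0 < \<epsilon>"
    and "valid_algorithm P" and "\<epsilon> \<le> m * d\<^sub>0\<^sup>2 / 8"
    and succ: "\<And>L A ystar. \<lbrakk>hierarchy_instance \<gamma> c \<beta> L A; strongly_convex m L; minimizer L ystar;
      norm (y\<^sub>0 - ystar) \<le> d\<^sub>0\<rbrakk> \<Longrightarrow> succeeds \<epsilon> P L A ystar"
  shows "\<exists>L A ystar. hierarchy_instance \<gamma> c \<beta> L A \<and> strongly_convex m L \<and> minimizer L ystar
    \<and> norm (y\<^sub>0 - ystar) \<le> d\<^sub>0
    \<and> ennreal (3/4 * (c / sqrt (8 * m * \<epsilon>)) powr \<gamma>) \<le> expected_cost \<gamma> c P A"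
proof -
  define a where "a = sqrt (8 * \<epsilon> / m)"
  define \<delta> where "\<delta> = sqrt (8 * m * \<epsilon>)"
  have "0 < \<delta>" using assms by (simp add: \<delta>_def)
  have "0 \<le> a" and ma2: "m * a\<^sup>2 = 8 * \<epsilon>"
    using assms by (auto simp: a_def)
  have "(m * a)\<^sup>2 = 8 * m * \<epsilon>"
    unfolding power_mult_distrib using ma2 by (simp add: power2_eq_square[of m])
  then have ma: "m * a = \<delta>"
    unfolding \<delta>_def using \<open>0 < m\<close> \<open>0 \<le> a\<close> by (intro real_sqrt_unique[symmetric]) auto
  have "a \<le> d\<^sub>0"
    unfolding a_def using assms by (intro real_le_lsqrt) (auto simp: field_simps)
  obtain e :: 'a where "norm e = 1"
    using vector_choose_size[of 1] by auto
  define v where "v = a *\<^sub>R e"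
  have v: "norm v = a"
    using \<open>norm e = 1\<close> \<open>0 \<le> a\<close> by (simp add: v_def)
  let ?A = "hiding_hierarchy \<gamma> c m y\<^sub>0 \<delta>"
  have inst: "hierarchy_instance \<gamma> c \<beta> (quadratic m z) (?A z)" if "norm (z - y\<^sub>0) = a" for z
    unfolding hierarchy_instance_def
    using that assms(4,5) ma
    by (auto intro: convex_on_if_strongly_convex[OF strongly_convex_quadratic[of m]]
        smooth_quadratic dyadic_hierarchy_hiding_center)
  have meas: "computed (?A z k) \<in> borel_measurable borel" for z k
    by (simp add: hiding_hierarchy_def)
  have Lmeas: "quadratic m z \<in> borel_measurable borel" for z :: 'a
    unfolding quadratic_def[abs_def] by measurable
  have mins: "minimizer (quadratic m z) z" for z :: 'a
    using \<open>0 < m\<close> by (simp add: minimizer_quadratic)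
  have zz: "norm (y\<^sub>0 + v - y\<^sub>0) = a" "norm (y\<^sub>0 - v - y\<^sub>0) = a"
    "norm (y\<^sub>0 - (y\<^sub>0 + v)) \<le> d\<^sub>0" "norm (y\<^sub>0 - (y\<^sub>0 - v)) \<le> d\<^sub>0"
    using v \<open>a \<le> d\<^sub>0\<close> by auto
  have "ennreal ((1 - 2 * \<epsilon> / (8 * \<epsilon>)) * (c / \<delta>) powr \<gamma>) \<le> expected_cost \<gamma> c P (?A (y\<^sub>0 + v))"
  proof (rule two_point_cost_bound[where K = "fine_levels \<delta>" and B = "?A (y\<^sub>0 - v)"])
    show "8 * \<epsilon> \<le> quadratic m (y\<^sub>0 + v) y - quadratic m (y\<^sub>0 + v) (y\<^sub>0 + v)
        + (quadratic m (y\<^sub>0 - v) y - quadratic m (y\<^sub>0 - v) (y\<^sub>0 - v))" for y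
      using quadratic_gap_sum[of m v y\<^sub>0 y] \<open>0 < m\<close> v ma2 by (simp add: quadratic_def)
    show "computed (?A (y\<^sub>0 + v) k) = computed (?A (y\<^sub>0 - v) k)" if "k \<notin> fine_levels \<delta>" for k
      using that by (simp add: hiding_hierarchy_def)
    show "(c / \<delta>) powr \<gamma> \<le> level_cost \<gamma> c k" if "k \<in> fine_levels \<delta>" for k
      using that assms \<open>0 < \<delta>\<close> by (intro level_cost_ge_if_fine)
    show "succeeds \<epsilon> P (quadratic m (y\<^sub>0 + v)) (?A (y\<^sub>0 + v)) (y\<^sub>0 + v)"
      "succeeds \<epsilon> P (quadratic m (y\<^sub>0 - v)) (?A (y\<^sub>0 - v)) (y\<^sub>0 - v)"
      by (intro succ inst zz mins strongly_convex_quadratic)+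
  qed (use assms meas Lmeas mins in auto)
  then have "ennreal (3/4 * (c / sqrt (8 * m * \<epsilon>)) powr \<gamma>) \<le> expected_cost \<gamma> c P (?A (y\<^sub>0 + v))"
    using \<open>0 < \<epsilon>\<close> by (simp add: \<delta>_def)
  then show ?thesis
    using inst[OF zz(1)] zz(3) mins strongly_convex_quadratic by blast
qed

section \<open>Both lower bounds\<close>

theorem theorem7:
  fixes \<gamma> c d\<^sub>0 \<beta> \<mu> \<epsilon> :: real
    and y\<^sub>0 :: "'a::euclidean_space"
    and P :: "('r, 'a) oracle_algorithm"
  assumes "0 < \<gamma>" and "0 < c" and "0 < d\<^sub>0"
    and "0 < \<mu>" and "\<mu> \<le> \<beta>" and "0 < \<epsilon>"
    and "valid_algorithm P"
  shows
    "(\<epsilon> \<le> \<beta> * d\<^sub>0\<^sup>2 / 8 \<longrightarrow>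
      (\<forall>L A ystar. hierarchy_instance \<gamma> c \<beta> L A \<and> minimizer L ystar \<and> norm (y\<^sub>0 - ystar) \<le> d\<^sub>0
         \<longrightarrow> succeeds \<epsilon> P L A ystar) \<longrightarrow>
      (\<exists>L A ystar. hierarchy_instance \<gamma> c \<beta> L A \<and> minimizer L ystar \<and> norm (y\<^sub>0 - ystar) \<le> d\<^sub>0
         \<and> expected_cost \<gamma> c P A \<ge> ennreal (3/4 * 8 powr (-\<gamma>) * (c * d\<^sub>0 / \<epsilon>) powr \<gamma>)))
   \<and> (\<epsilon> \<le> \<mu> * d\<^sub>0\<^sup>2 / 8 \<longrightarrow>
      (\<forall>L A ystar. hierarchy_instance \<gamma> c \<beta> L A \<and> strongly_convex \<mu> L
           \<and> minimizer L ystar \<and> norm (y\<^sub>0 - ystar) \<le> d\<^sub>0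
         \<longrightarrow> succeeds \<epsilon> P L A ystar) \<longrightarrow>
      (\<exists>L A ystar. hierarchy_instance \<gamma> c \<beta> L A \<and> strongly_convex \<mu> L
         \<and> minimizer L ystar \<and> norm (y\<^sub>0 - ystar) \<le> d\<^sub>0
         \<and> expected_cost \<gamma> c P A \<ge> ennreal (3/4 * (c / sqrt (8 * \<mu> * \<epsilon>)) powr \<gamma>)))"
proof (intro conjI impI)
  assume small: "\<epsilon> \<le> \<beta> * d\<^sub>0\<^sup>2 / 8"
    and succ: "\<forall>L A ystar. hierarchy_instance \<gamma> c \<beta> L A \<and> minimizer L ystar
      \<and> norm (y\<^sub>0 - ystar) \<le> d\<^sub>0 \<longrightarrow> succeeds \<epsilon> P L A ystar"
  \<comment> \<open>the smallest curvature whose two centres still lie within \<open>d\<^sub>0\<close> of \<open>y\<^sub>0\<close>\<close>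
  define m where "m = 8 * \<epsilon> / d\<^sub>0\<^sup>2"
  have m: "0 < m" "m \<le> \<beta>" "\<epsilon> \<le> m * d\<^sub>0\<^sup>2 / 8"
    using assms small by (auto simp: m_def field_simps)
  have "8 * m * \<epsilon> = (8 * \<epsilon> / d\<^sub>0)\<^sup>2"
    by (simp add: m_def power2_eq_square)
  then have "sqrt (8 * m * \<epsilon>) = 8 * \<epsilon> / d\<^sub>0"
    using assms by simp
  then have "c / sqrt (8 * m * \<epsilon>) = inverse 8 * (c * d\<^sub>0 / \<epsilon>)"
    by (simp add: field_simps)
  then have eq: "(c / sqrt (8 * m * \<epsilon>)) powr \<gamma> = 8 powr (-\<gamma>) * (c * d\<^sub>0 / \<epsilon>) powr \<gamma>"
    using assms by (simp only: powr_mult) (simp add: powr_divide powr_minus_divide)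
  obtain L A ystar where "hierarchy_instance \<gamma> c \<beta> L A" "minimizer L ystar" "norm (y\<^sub>0 - ystar) \<le> d\<^sub>0"
    and "ennreal (3/4 * (c / sqrt (8 * m * \<epsilon>)) powr \<gamma>) \<le> expected_cost \<gamma> c P A"
    using quadratic_pair_cost_bound[OF assms(1-3) m(1,2) assms(6,7) m(3), of y\<^sub>0] succ by blast
  then show "\<exists>L A ystar. hierarchy_instance \<gamma> c \<beta> L A \<and> minimizer L ystar \<and> norm (y\<^sub>0 - ystar) \<le> d\<^sub>0
      \<and> expected_cost \<gamma> c P A \<ge> ennreal (3/4 * 8 powr (-\<gamma>) * (c * d\<^sub>0 / \<epsilon>) powr \<gamma>)"
    unfolding eq by (auto simp only: mult.assoc)
next
  assume "\<epsilon> \<le> \<mu> * d\<^sub>0\<^sup>2 / 8"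
    and "\<forall>L A ystar. hierarchy_instance \<gamma> c \<beta> L A \<and> strongly_convex \<mu> L
      \<and> minimizer L ystar \<and> norm (y\<^sub>0 - ystar) \<le> d\<^sub>0 \<longrightarrow> succeeds \<epsilon> P L A ystar"
  then show "\<exists>L A ystar. hierarchy_instance \<gamma> c \<beta> L A \<and> strongly_convex \<mu> L
      \<and> minimizer L ystar \<and> norm (y\<^sub>0 - ystar) \<le> d\<^sub>0
      \<and> expected_cost \<gamma> c P A \<ge> ennreal (3/4 * (c / sqrt (8 * \<mu> * \<epsilon>)) powr \<gamma>)"
    using assms by (intro quadratic_pair_cost_bound) auto
qed

end
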